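(* (i) A regular $C^2$ space curve is a slant helix if and only if it has a Frenet development $(\kappa_{SH},\tau_{SH})$ satisfying \[ \kappa_{SH}=\frac1m\,\varphi'\cos\varphi,\qquad \tau_{SH}=\frac1m\,\varphi'\sin\varphi \] with a differentiable function $\varphi(s)$ and $m=\cot\theta\neq0$, where $\theta\in(0,\pi/2)$. (ii) Let such a Frenet development be given, and let $n=\cos\theta$, $\Omega(s)=\varphi(s)/n$, $\lambda_1=1-n$, $\lambda_2=1+n$. Then the tangent vector of the slant helix thus characterized can be parametrized (up to a rigid motion) as \[ \mathbf T_{SH}(s)=\frac12\begin{pmatrix}\lambda_1\cos(\lambda_2\Omega(s))+\lambda_2\cos(\lambda_1\Omega(s))\\ \lambda_1\sin(\lambda_2\Omega(s))+\lambda_2\sin(\lambda_1\Omega(s))\\ 2\,\frac nm\,\sin(n\,\Omega(s))\end{pmatrix}. \] (iii) The slant helix is the successor curve of a helix with curvature $\kappa_H=\varphi'/m$ and torsion $\tau_H=\varphi'$. The regular arcs traced by $\mathbf T_{SH}$ are spherical helices, and the slant helix has a Darboux vector with constant slope $\pi/2-\theta$ and speed of precession $\omega=\kappa_H$. Slant helices are generic.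
   Context: Curves are regular $C^2$ curves in oriented Euclidean $\mathbb R^3$, parametrized by arc length $s$ on an interval; a prime denotes $d/ds$; $\mathbf T=\mathbf x'$ is the unit tangent of $\mathbf x$. A Frenet apparatus of a curve is a tuple $(\mathbf T,\mathbf N,\mathbf B,\kappa,\tau)$ in which $(\mathbf T,\mathbf N,\mathbf B)$ is a positively oriented orthonormal frame along the curve (a Frenet frame), $\mathbf T$ is the unit tangent, $\kappa$ (signed curvature) and $\tau$ (torsion) are continuous real functions, and $\mathbf T'=\kappa\mathbf N$, $\mathbf N'=-\kappa\mathbf T+\tau\mathbf B$, $\mathbf B'=-\tau\mathbf N$. The curvature may vanish, even on intervals, so the frame need not be unique. $\mathbf N$ is called a principal normal, and the pair $(\kappa,\tau)$ a Frenet development of the curve; it determines the curve up to a rigid motion. A Frenet curve is a curve that possesses a Frenet frame. A Frenet apparatus is generic if on every interval on which $\kappa$ vanishes, $\tau$ also vanishes; a Frenet curve is generic if it has a generic Frenet frame. The Darboux vector is $\mathbf D=\tau\mathbf T+\kappa\mathbf B$; its direction determines the frame's momentary axis of motion (the centrode), and its length $\omega=\sqrt{\kappa^2+\tau^2}$ is the angular speed. A vector field along a curve has constant slope $\theta$ if it makes the constant angle $\theta$ with a fixed direction. A (general) helix is a curve whose unit tangent has constant slope; a spherical helix is a helix lying on a sphere. A slant helix is a Frenet curve that has a principal normal with constant slope $\theta\in(0,\pi/2)$. A successor curve of a unit speed $C^2$ curve $\mathbf y(s)$ with unit tangent $\mathbf t(s)$ is a curve $\mathbf x(s)$ that has $\mathbf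 t$ as principal normal, i.e. $\mathbf x$ has a Frenet frame $(\mathbf T,\mathbf N,\mathbf B)$ with $\mathbf N\equiv\mathbf t$.
   Formalization: In (iii), as ω ≥ 0 but κ_H = φ'/m may be negative or change sign, the claims are corrected: ω = |κ_H|, and the Darboux vector is κ_H times a continuous unit field of constant slope π/2−θ; the literal slope and speed claims are stated where φ' ≥ 0. *)

theory Defs
  imports "HOL-Analysis.Analysis"
begin

text \<open>
  Parameter intervals may be open, closed, half-open or unbounded; a single point is excluded,
  so that the one-sided derivatives \<open>at s within I\<close> are unique.
\<close>

definition nondegenerate_interval :: "real set \<Rightarrow> bool" where
  "nondegenerate_interval I \<longleftrightarrow> is_interval I \<and> (\<exists>a\<in>I. \<exists>b\<in>I. a < b)"

definition unit_speed_C2_curve :: "real set \<Rightarrow> (real \<Rightarrow> real^3) \<Rightarrow> bool" where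
  "unit_speed_C2_curve I x \<longleftrightarrow>
     nondegenerate_interval I \<and>
     (\<exists>x' x''. (\<forall>s\<in>I. (x has_vector_derivative x' s) (at s within I) \<and> norm (x' s) = 1 \<and>
                       (x' has_vector_derivative x'' s) (at s within I)) \<and>
               continuous_on I x'')"

definition unit_tangent :: "real set \<Rightarrow> (real \<Rightarrow> real^3) \<Rightarrow> real \<Rightarrow> real^3" where
  "unit_tangent I x s = vector_derivative x (at s within I)"

definition positively_oriented_orthonormal :: "real^3 \<Rightarrow> real^3 \<Rightarrow> real^3 \<Rightarrow> bool" where
  "positively_oriented_orthonormal t n b \<longleftrightarrow>
     norm t = 1 \<and> norm n = 1 \<and> norm b = 1 \<and>
     orthogonal t n \<and> orthogonal n b \<and> orthogonal b t \<and>
     det (vector [t, n, b] :: real^3^3) > 0"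

definition frenet_apparatus ::
    "real set \<Rightarrow> (real \<Rightarrow> real^3) \<Rightarrow> (real \<Rightarrow> real^3) \<Rightarrow> (real \<Rightarrow> real^3) \<Rightarrow> (real \<Rightarrow> real^3) \<Rightarrow>
     (real \<Rightarrow> real) \<Rightarrow> (real \<Rightarrow> real) \<Rightarrow> bool" where
  "frenet_apparatus I x T N B \<kappa> \<tau> \<longleftrightarrow>
     unit_speed_C2_curve I x \<and>
     (\<forall>s\<in>I. (x has_vector_derivative T s) (at s within I)) \<and>
     (\<forall>s\<in>I. positively_oriented_orthonormal (T s) (N s) (B s)) \<and>
     continuous_on I \<kappa> \<and> continuous_on I \<tau> \<and>
     (\<forall>s\<in>I. (T has_vector_derivative \<kappa> s *\<^sub>R N s) (at s within I)) \<and>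
     (\<forall>s\<in>I. (N has_vector_derivative - (\<kappa> s *\<^sub>R T s) + \<tau> s *\<^sub>R B s) (at s within I)) \<and>
     (\<forall>s\<in>I. (B has_vector_derivative - (\<tau> s *\<^sub>R N s)) (at s within I))"

definition frenet_development ::
    "real set \<Rightarrow> (real \<Rightarrow> real^3) \<Rightarrow> (real \<Rightarrow> real) \<Rightarrow> (real \<Rightarrow> real) \<Rightarrow> bool" where
  "frenet_development I x \<kappa> \<tau> \<longleftrightarrow> (\<exists>T N B. frenet_apparatus I x T N B \<kappa> \<tau>)"

text \<open>
  Genericity only concerns intervals of positive length: at an isolated zero of the curvature the
  torsion need not vanish.
\<close>

definition generic_development :: "real set \<Rightarrow> (real \<Rightarrow> real) \<Rightarrow> (real \<Rightarrow> real) \<Rightarrow> bool" where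
  "generic_development I \<kappa> \<tau> \<longleftrightarrow>
     (\<forall>J. nondegenerate_interval J \<and> J \<subseteq> I \<and> (\<forall>s\<in>J. \<kappa> s = 0) \<longrightarrow> (\<forall>s\<in>J. \<tau> s = 0))"

definition generic_frenet_curve :: "real set \<Rightarrow> (real \<Rightarrow> real^3) \<Rightarrow> bool" where
  "generic_frenet_curve I x \<longleftrightarrow>
     (\<exists>T N B \<kappa> \<tau>. frenet_apparatus I x T N B \<kappa> \<tau> \<and> generic_development I \<kappa> \<tau>)"

definition darboux_vector ::
    "(real \<Rightarrow> real^3) \<Rightarrow> (real \<Rightarrow> real^3) \<Rightarrow> (real \<Rightarrow> real) \<Rightarrow> (real \<Rightarrow> real) \<Rightarrow> real \<Rightarrow> real^3" where
  "darboux_vector T B \<kappa> \<tau> s = \<tau> s *\<^sub>R T s + \<kappa> s *\<^sub>R B s"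

definition angular_speed :: "(real \<Rightarrow> real) \<Rightarrow> (real \<Rightarrow> real) \<Rightarrow> real \<Rightarrow> real" where
  "angular_speed \<kappa> \<tau> s = sqrt ((\<kappa> s)\<^sup>2 + (\<tau> s)\<^sup>2)"

definition vec_angle :: "real^3 \<Rightarrow> real^3 \<Rightarrow> real" where
  "vec_angle u v = arccos ((u \<bullet> v) / (norm u * norm v))"

text \<open>
  A zero vector has no direction, so the angle condition is imposed where the field does not vanish.
  The set \<open>I\<close> is arbitrary, so that slopes can be stated over parts of a parameter interval.
\<close>

definition has_constant_slope :: "real set \<Rightarrow> (real \<Rightarrow> real^3) \<Rightarrow> real \<Rightarrow> bool" where
  "has_constant_slope I V \<theta> \<longleftrightarrow>
     (\<exists>d. d \<noteq> 0 \<and> (\<forall>s\<in>I. V s \<noteq> 0 \<longrightarrow> vec_angle (V s) d = \<theta>))"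

definition helix :: "real set \<Rightarrow> (real \<Rightarrow> real^3) \<Rightarrow> bool" where
  "helix I x \<longleftrightarrow>
     unit_speed_C2_curve I x \<and> (\<exists>\<theta>. has_constant_slope I (unit_tangent I x) \<theta>)"

definition spherical_helix :: "real set \<Rightarrow> (real \<Rightarrow> real^3) \<Rightarrow> bool" where
  "spherical_helix I x \<longleftrightarrow> helix I x \<and> (\<exists>p r. r > 0 \<and> x ` I \<subseteq> sphere p r)"

definition slant_helix_of_slope :: "real set \<Rightarrow> (real \<Rightarrow> real^3) \<Rightarrow> real \<Rightarrow> bool" where
  "slant_helix_of_slope I x \<theta> \<longleftrightarrow>
     (\<exists>T N B \<kappa> \<tau>. frenet_apparatus I x T N B \<kappa> \<tau> \<and> has_constant_slope I N \<theta>)"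

definition slant_helix :: "real set \<Rightarrow> (real \<Rightarrow> real^3) \<Rightarrow> bool" where
  "slant_helix I x \<longleftrightarrow> (\<exists>\<theta>. 0 < \<theta> \<and> \<theta> < pi / 2 \<and> slant_helix_of_slope I x \<theta>)"

text \<open>\<open>x\<close> is a successor curve of \<open>y\<close>.\<close>

definition successor_curve :: "real set \<Rightarrow> (real \<Rightarrow> real^3) \<Rightarrow> (real \<Rightarrow> real^3) \<Rightarrow> bool" where
  "successor_curve I y x \<longleftrightarrow>
     unit_speed_C2_curve I y \<and>
     (\<exists>T N B \<kappa> \<tau>. frenet_apparatus I x T N B \<kappa> \<tau> \<and> (\<forall>s\<in>I. N s = unit_tangent I y s))"

text \<open>\<open>\<phi>'\<close> stands for the derivative of \<open>\<phi>\<close> on \<open>I\<close>, and \<open>cot \<theta>\<close> for \<open>m\<close>.\<close>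

definition slant_helix_equations ::
    "real set \<Rightarrow> real \<Rightarrow> (real \<Rightarrow> real) \<Rightarrow> (real \<Rightarrow> real) \<Rightarrow> (real \<Rightarrow> real) \<Rightarrow> (real \<Rightarrow> real) \<Rightarrow> bool" where
  "slant_helix_equations I \<theta> \<kappa> \<tau> \<phi> \<phi>' \<longleftrightarrow>
     (\<forall>s\<in>I. (\<phi> has_real_derivative \<phi>' s) (at s within I)) \<and>
     (\<forall>s\<in>I. \<kappa> s = 1 / cot \<theta> * \<phi>' s * cos (\<phi> s)) \<and>
     (\<forall>s\<in>I. \<tau> s = 1 / cot \<theta> * \<phi>' s * sin (\<phi> s))"

definition slant_helix_tangent :: "real \<Rightarrow> (real \<Rightarrow> real) \<Rightarrow> real \<Rightarrow> real^3" where
  "slant_helix_tangent \<theta> \<phi> s =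
     (let m = cot \<theta>; n = cos \<theta>; \<Omega> = \<phi> s / n; l1 = 1 - n; l2 = 1 + n in
      (1 / 2) *\<^sub>R vector
        [l1 * cos (l2 * \<Omega>) + l2 * cos (l1 * \<Omega>),
         l1 * sin (l2 * \<Omega>) + l2 * sin (l1 * \<Omega>),
         2 * (n / m) * sin (n * \<Omega>)])"

definition rigid_motion :: "(real^3 \<Rightarrow> real^3) \<Rightarrow> bool" where
  "rigid_motion g \<longleftrightarrow> (\<exists>R b. rotation_matrix R \<and> g = (\<lambda>v. R *v v + b))"

definition regular_C1_arc :: "real set \<Rightarrow> (real \<Rightarrow> real^3) \<Rightarrow> bool" where
  "regular_C1_arc J c \<longleftrightarrow>
     nondegenerate_interval J \<and>
     (\<exists>c'. (\<forall>s\<in>J. (c has_vector_derivative c' s) (at s within J) \<and> c' s \<noteq> 0) \<and>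
           continuous_on J c')"

text \<open>
  \<open>y\<close> on \<open>K\<close> is the same oriented arc as \<open>c\<close> on \<open>J\<close>, via the \<open>C\<^sup>1\<close> parameter change \<open>\<sigma>\<close> with
  positive derivative \<open>v\<close>. When \<open>y\<close> has unit speed, this is the parametrization of \<open>c\<close> by arc length
  and \<open>v\<close> is the speed of \<open>c\<close>.
\<close>

definition reparametrizes :: "real set \<Rightarrow> (real \<Rightarrow> real^3) \<Rightarrow> real set \<Rightarrow> (real \<Rightarrow> real^3) \<Rightarrow> bool" where
  "reparametrizes K y J c \<longleftrightarrow>
     (\<exists>\<sigma> v. (\<forall>s\<in>J. (\<sigma> has_real_derivative v s) (at s within J) \<and> v s > 0) \<and>
            continuous_on J v \<and> \<sigma> ` J = K \<and> (\<forall>s\<in>J. c s = y (\<sigma> s)))"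

end

theory Submission
  imports Defs
begin

text \<open>
  Given \<open>\<phi>\<close>, let \<open>E = sin \<phi> T + cos \<phi> B\<close> be the unit Darboux direction and \<open>F = cos \<phi> T - sin \<phi> B\<close>.
  Then \<open>N' = - (\<phi>'/m) F\<close> and \<open>E' = \<phi>' F\<close>, so that \<open>(N, - F, E)\<close> is the Frenet frame of a curve with
  curvature \<open>\<phi>'/m\<close> and torsion \<open>\<phi>'\<close>, and \<open>cos \<theta> N + sin \<theta> E\<close> is a constant unit vector. This vector is
  the common axis of all the slopes in the theorem. In the plane perpendicular to it, \<open>F\<close> rotates
  with angle \<open>\<Omega>\<close>; expressing \<open>T\<close> through \<open>F\<close>, \<open>N\<close> and \<open>E\<close> gives the formula for the tangent.
  Conversely, if \<open>N\<close> makes the angle \<open>\<theta>\<close> with a unit vector \<open>d\<close>, then the components of \<open>d\<close> along \<open>T\<close>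
  and \<open>B\<close> are \<open>sin \<theta> sin \<phi>\<close> and \<open>sin \<theta> cos \<phi>\<close> for some function \<open>\<phi>\<close>, which is differentiable.
\<close>

section \<open>Calculus on real intervals\<close>

text \<open>A connected set with more than one point has no isolated points. Hence derivatives
  within the interval are unique, also at its endpoints.\<close>

lemma nondegenerate_interval_at_within_neq_bot:
  assumes "nondegenerate_interval I" "s \<in> I"
  shows "at s within I \<noteq> bot"
proof -
  have "connected I" "\<And>z. I \<noteq> {z}"
    using assms(1) is_interval_connected unfolding nondegenerate_interval_def by force+
  with assms(2) show ?thesis
    by (simp add: connected_imp_perfect trivial_limit_within)
qed

lemma unit_tangent_eqI:
  assumes "nondegenerate_interval I" "s \<in> I" "(x has_vector_derivative v) (at s within I)"
  shows "unit_tangent I x s = v"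
  unfolding unit_tangent_def
  using assms nondegenerate_interval_at_within_neq_bot vector_derivative_within by blast

lemma has_vector_derivative_zero_eq:
  assumes "is_interval I" "\<And>s. s \<in> I \<Longrightarrow> (f has_vector_derivative 0) (at s within I)"
    and "s \<in> I" "t \<in> I"
  shows "f s = f t"
proof -
  obtain c where "\<And>t. t \<in> I \<Longrightarrow> f t = c"
    using has_vector_derivative_zero_constant[OF is_interval_convex[OF assms(1)] assms(2)] by blast
  with assms(3,4) show ?thesis by simp
qed

lemma continuous_on_has_vector_derivative:
  assumes "\<And>s. s \<in> I \<Longrightarrow> (f has_vector_derivative f' s) (at s within I)"
  shows "continuous_on I f"
  unfolding continuous_on_eq_continuous_within
  using assms has_vector_derivative_continuous by blast

text \<open>The interval may lack endpoints, so the fundamental theorem is applied on a compact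
  \<open>{a..b}\<close> that coincides with \<open>I\<close> near \<open>s\<close>.\<close>

lemma antiderivative_on_interval:
  fixes f :: "real \<Rightarrow> 'a::euclidean_space"
  assumes I: "is_interval I" and f: "continuous_on I f"
  obtains F where "\<And>s. s \<in> I \<Longrightarrow> (F has_vector_derivative f s) (at s within I)"
proof (cases "I = {}")
  case False
  then obtain c where c: "c \<in> I" by auto
  have "((\<lambda>u. LBINT y=c..u. f y) has_vector_derivative f s) (at s within I)" if s: "s \<in> I" for s
  proof -
    \<comment> \<open>No point of \<open>I\<close> just left of \<open>s\<close> may be lost. Either
      \<open>I\<close> has a point below both \<open>c\<close> and \<open>s\<close>, or
      \<open>min c s\<close> is its least element and any \<open>l\<close> below \<open>s\<close>
      serves, here \<open>s - 1\<close>. The choice of \<open>b\<close> and \<open>r\<close> mirrors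
      this.\<close>
    obtain a l where a: "a \<in> I" "a \<le> c" "a \<le> s" "l < s" "\<And>t. t \<in> I \<Longrightarrow> l < t \<Longrightarrow> a \<le> t"
    proof (cases "\<exists>p\<in>I. p < min c s")
      case True
      then obtain p where "p \<in> I" "p < min c s" by blast
      then show ?thesis by (intro that[of p p]) auto
    next
      case False
      then have "\<And>t. t \<in> I \<Longrightarrow> min c s \<le> t" by force
      then show ?thesis using c s by (intro that[of "min c s" "s - 1"]) (auto simp: min_def)
    qed
    obtain b r where b: "b \<in> I" "c \<le> b" "s \<le> b" "s < r" "\<And>t. t \<in> I \<Longrightarrow> t < r \<Longrightarrow> t \<le> b"
    proof (cases "\<exists>p\<in>I. max c s < p")
      case True
      then obtain p where "p \<in> I" "max c s < p" by blast
      then show ?thesis by (intro that[of p p]) auto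
    next
      case False
      then have "\<And>t. t \<in> I \<Longrightarrow> t \<le> max c s" by force
      then show ?thesis using c s by (intro that[of "max c s" "s + 1"]) (auto simp: max_def)
    qed
    have sub: "{a..b} \<subseteq> I"
      using I a(1) b(1) by (meson atLeastAtMost_iff is_interval_1 subsetI)
    have "at s within I = at s within {a..b}"
      by (rule at_within_nhd[where S="{l<..<r}"]) (use a b sub in auto)
    moreover have "((\<lambda>u. LBINT y=c..u. f y) has_vector_derivative f s) (at s within {a..b})"
      using a b continuous_on_subset[OF f sub] by (intro interval_integral_FTC2) auto
    ultimately show ?thesis by simp
  qed
  then show ?thesis by (rule that)
qed auto

lemma real_antiderivative_on_interval:
  fixes f :: "real \<Rightarrow> real"
  assumes "is_interval I" "continuous_on I f"
  obtains F where "\<And>s. s \<in> I \<Longrightarrow> (F has_real_derivative f s) (at s within I)"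
  using antiderivative_on_interval[OF assms] has_real_derivative_iff_has_vector_derivative by metis

text \<open>The difference quotient of \<open>g\<close> at \<open>y\<close> is the reciprocal of
  that of \<open>f\<close> at \<open>g y\<close>, and continuity of \<open>g\<close> lets
  \<open>g y\<close> tend to \<open>a\<close> as \<open>y\<close> tends to
  \<open>f a\<close>.\<close>

lemma has_real_derivative_inverse_within:
  fixes f g :: "real \<Rightarrow> real"
  assumes f: "(f has_real_derivative v) (at a within S)" and v: "v \<noteq> 0" and a: "a \<in> S"
    and gf: "\<And>t. t \<in> S \<Longrightarrow> g (f t) = t"
    and g: "continuous (at (f a) within f ` S) g"
  shows "(g has_real_derivative inverse v) (at (f a) within f ` S)"
proof -
  \<comment> \<open>Since \<open>g (f t) = t\<close>, the value \<open>g y\<close> equals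
    \<open>a\<close> only for \<open>y = f a\<close>, so the limit avoids the point \<open>a\<close>
    itself.\<close>
  have "filterlim g (at a within S) (at (f a) within f ` S)"
    using g a gf by (auto simp: filterlim_at continuous_within eventually_at_filter intro!: always_eventually)
  then have "((\<lambda>y. (f (g y) - f a) / (g y - a)) \<longlongrightarrow> v) (at (f a) within f ` S)"
    using f unfolding has_field_derivative_iff by (rule filterlim_compose[rotated])
  then have "((\<lambda>y. inverse ((f (g y) - f a) / (g y - a))) \<longlongrightarrow> inverse v) (at (f a) within f ` S)"
    using v by (intro tendsto_inverse)
  moreover have "\<forall>\<^sub>F y in at (f a) within f ` S.
      inverse ((f (g y) - f a) / (g y - a)) = (g y - g (f a)) / (y - f a)"
    using gf a by (auto simp: eventually_at_filter intro!: always_eventually)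
  ultimately show ?thesis
    unfolding has_field_derivative_iff by (rule Lim_transform_eventually)
qed

text \<open>Arc length is an antiderivative \<open>\<sigma>\<close> of the speed \<open>v\<close>
  and strictly increasing. Composing \<open>c\<close> with its inverse cancels \<open>v\<close> in
  the chain rule and leaves the tangent \<open>u\<close>.\<close>

lemma arc_length_reparametrization:
  fixes c u u' :: "real \<Rightarrow> real^3" and v :: "real \<Rightarrow> real"
  assumes J: "nondegenerate_interval J"
    and c: "\<And>s. s \<in> J \<Longrightarrow> (c has_vector_derivative v s *\<^sub>R u s) (at s within J)"
    and v: "\<And>s. s \<in> J \<Longrightarrow> v s > 0" "continuous_on J v"
    and u: "\<And>s. s \<in> J \<Longrightarrow> norm (u s) = 1"
      "\<And>s. s \<in> J \<Longrightarrow> (u has_vector_derivative u' s) (at s within J)" "continuous_on J u'"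
  obtains K y where "reparametrizes K y J c" "unit_speed_C2_curve K y"
    "\<And>q. q \<in> K \<Longrightarrow> \<exists>s\<in>J. y q = c s \<and> unit_tangent K y q = u s"
proof -
  from J have int: "is_interval J" by (simp add: nondegenerate_interval_def)
  obtain \<sigma> where \<sigma>: "\<And>s. s \<in> J \<Longrightarrow> (\<sigma> has_real_derivative v s) (at s within J)"
    using real_antiderivative_on_interval[OF int v(2)] by blast
  have less: "\<sigma> a < \<sigma> b" if "a \<in> J" "b \<in> J" "a < b" for a b
  proof -
    have sub: "{a..b} \<subseteq> J"
      using int that by (meson atLeastAtMost_iff is_interval_1 subsetI)
    have "(\<sigma> has_derivative (*) (v t)) (at t within {a..b})" if "a \<le> t" "t \<le> b" for t
      using \<sigma>[of t] sub that has_derivative_subset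
      by (fastforce simp: has_field_derivative_def)
    from mvt_simple[OF \<open>a < b\<close> this]
    obtain t where t: "t \<in> {a<..<b}" "\<sigma> b - \<sigma> a = v t * (b - a)" by blast
    then have "0 < v t" using sub by (intro v(1)) auto
    then have "0 < v t * (b - a)" using \<open>a < b\<close> by simp
    with t(2) show ?thesis by linarith
  qed
  define K where "K = \<sigma> ` J"
  have cont: "continuous_on J \<sigma>"
    using \<sigma> by (intro DERIV_continuous_on)
  have "inj_on \<sigma> J"
    by (rule linorder_inj_onI') (use less in force)
  moreover have "path_connected J"
    using int is_interval_path_connected by blast
  \<comment> \<open>A continuous injection of an interval is a homeomorphism onto its image. This
    supplies the inverse \<open>g\<close> together with its continuity.\<close>
  ultimately obtain g where "homeomorphism J K \<sigma> g"
    using homeomorphism_into_1d[of J \<sigma> K] cont K_def by blast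
  then have g: "\<And>s. s \<in> J \<Longrightarrow> g (\<sigma> s) = s" "g ` K = J" "continuous_on K g"
    by (auto simp: homeomorphism_def)
  have gd: "(g has_real_derivative inverse (v s)) (at (\<sigma> s) within K)" if s: "s \<in> J" for s
    unfolding K_def
    using \<sigma>[OF s] v(1)[OF s] s g
    by (intro has_real_derivative_inverse_within)
       (auto simp: K_def continuous_on_eq_continuous_within)
  have chain: "((\<lambda>q. h (g q)) has_vector_derivative inverse (v s) *\<^sub>R h') (at (\<sigma> s) within K)"
    if "s \<in> J" "(h has_vector_derivative h') (at s within J)" for h h' s
    using vector_diff_chain_within[of g "inverse (v s)" "\<sigma> s" K h h'] gd that g
    by (simp add: has_real_derivative_iff_has_vector_derivative o_def)
  have K: "nondegenerate_interval K"
    unfolding nondegenerate_interval_def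
  proof
    show "is_interval K"
      unfolding K_def is_interval_connected_1
      using cont int is_interval_connected_1 connected_continuous_image by blast
    show "\<exists>a\<in>K. \<exists>b\<in>K. a < b"
      using J less unfolding nondegenerate_interval_def K_def by blast
  qed
  have yd: "((\<lambda>q. c (g q)) has_vector_derivative u (g q)) (at q within K)"
    and ud: "((\<lambda>q. u (g q)) has_vector_derivative inverse (v (g q)) *\<^sub>R u' (g q)) (at q within K)"
    if "q \<in> K" for q
    using that chain[OF _ c] chain[OF _ u(2)] v(1) unfolding K_def by (force simp: g)+
  show thesis
  proof
    show "reparametrizes K (\<lambda>q. c (g q)) J c"
      unfolding reparametrizes_def
      using \<sigma> v g by (intro exI[of _ \<sigma>] exI[of _ v]) (auto simp: K_def)
    show "unit_speed_C2_curve K (\<lambda>q. c (g q))"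
      unfolding unit_speed_C2_curve_def
    proof (intro conjI exI ballI)
      show "continuous_on K (\<lambda>q. inverse (v (g q)) *\<^sub>R u' (g q))"
        using v u(3) g
        by (intro continuous_intros continuous_on_compose2[OF v(2) g(3)] continuous_on_compose2[OF u(3) g(3)])
           force+
    qed (use K yd ud u g in auto)
    show "\<exists>s\<in>J. c (g q) = c s \<and> unit_tangent K (\<lambda>q. c (g q)) q = u s" if "q \<in> K" for q
      using that g(2) unit_tangent_eqI[OF K that yd[OF that]] by blast
  qed
qed

section \<open>Frames and slopes\<close>

lemma positively_oriented_orthonormal_inner:
  assumes "positively_oriented_orthonormal u v w"
  shows "u \<bullet> u = 1" "v \<bullet> v = 1" "w \<bullet> w = 1" "u \<bullet> v = 0" "v \<bullet> u = 0" "v \<bullet> w = 0" "w \<bullet> v = 0"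
    "w \<bullet> u = 0" "u \<bullet> w = 0"
  using assms
  by (auto simp: positively_oriented_orthonormal_def orthogonal_def norm_eq_1 inner_commute)

lemma positively_oriented_orthonormal_cyclic:
  assumes "positively_oriented_orthonormal u v w"
  shows "positively_oriented_orthonormal v w u"
proof -
  have "det (vector [v, w, u] :: real^3^3) = det (vector [u, v, w] :: real^3^3)"
    by (simp add: det_3)
  with assms show ?thesis
    by (simp add: positively_oriented_orthonormal_def)
qed

text \<open>The determinant is multiplied by \<open>p\<^sup>2 + q\<^sup>2\<close>. Together with the
  cyclic shift, this produces all later frames from the Frenet frame.\<close>

lemma positively_oriented_orthonormal_rotate:
  assumes "positively_oriented_orthonormal u v w" and pq: "p\<^sup>2 + q\<^sup>2 = 1"
  shows "positively_oriented_orthonormal (p *\<^sub>R u + q *\<^sub>R v) (p *\<^sub>R v - q *\<^sub>R u) w"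
proof -
  have "det (vector [p *\<^sub>R u + q *\<^sub>R v, p *\<^sub>R v - q *\<^sub>R u, w] :: real^3^3) =
      (p\<^sup>2 + q\<^sup>2) * det (vector [u, v, w] :: real^3^3)"
    by (simp add: det_3 algebra_simps power2_eq_square)
  with assms pq positively_oriented_orthonormal_inner[OF assms(1)] show ?thesis
    by (simp add: positively_oriented_orthonormal_def orthogonal_def norm_eq_1 inner_simps
        power2_eq_square)
qed

text \<open>Orthonormal rows force the determinant to be 1 or -1, and the orientation selects
  1.\<close>

lemma rotation_matrix_vector:
  assumes "positively_oriented_orthonormal u v w"
  shows "rotation_matrix (vector [u, v, w] :: real^3^3)"
proof -
  let ?R = "vector [u, v, w] :: real^3^3"
  have "row 1 ?R = u" "row 2 ?R = v" "row 3 ?R = w"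
    by (simp_all add: row_def)
  then have "orthogonal_matrix ?R"
    using assms
    by (simp add: orthogonal_matrix_orthonormal_rows forall_3 positively_oriented_orthonormal_def
        orthogonal_commute)
  then show ?thesis
    using assms det_orthogonal_matrix[of ?R]
    by (auto simp: rotation_matrix_def positively_oriented_orthonormal_def)
qed

text \<open>The product form holds trivially where \<open>V s\<close> vanishes. Elsewhere
  \<open>arccos\<close> recovers \<open>\<theta>\<close>, which lies between 0 and
  \<open>pi\<close>.\<close>

lemma has_constant_slopeI:
  assumes "norm d = 1" "0 \<le> \<theta>" "\<theta> \<le> pi"
    and "\<And>s. s \<in> I \<Longrightarrow> V s \<bullet> d = norm (V s) * cos \<theta>"
  shows "has_constant_slope I V \<theta>"
  unfolding has_constant_slope_def vec_angle_def
  using assms by (intro exI[of _ d]) (auto simp: arccos_cos)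

text \<open>Normalizing the direction to \<open>sgn d\<close> turns the angle into an inner product,
  and Cauchy-Schwarz keeps it in the range where \<open>cos\<close> undoes
  \<open>arccos\<close>.\<close>

lemma has_constant_slopeE:
  assumes "has_constant_slope I V \<theta>" "\<And>s. s \<in> I \<Longrightarrow> norm (V s) = 1"
  obtains d where "norm d = 1" "\<And>s. s \<in> I \<Longrightarrow> V s \<bullet> d = cos \<theta>"
proof -
  obtain d where d: "d \<noteq> 0" "\<And>s. s \<in> I \<Longrightarrow> V s \<noteq> 0 \<Longrightarrow> vec_angle (V s) d = \<theta>"
    using assms(1) unfolding has_constant_slope_def by blast
  show thesis
  proof
    show "norm (sgn d) = 1" using d(1) by (simp add: norm_sgn)
    fix s assume s: "s \<in> I"
    have "V s \<noteq> 0"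
      using assms(2)[OF s] by auto
    with d(2)[OF s] have "vec_angle (V s) d = \<theta>"
      by blast
    then have "arccos (V s \<bullet> sgn d) = \<theta>"
      by (simp add: vec_angle_def sgn_div_norm divide_inverse mult.commute assms(2)[OF s])
    moreover have "\<bar>V s \<bullet> sgn d\<bar> \<le> 1"
      using Cauchy_Schwarz_ineq2[of "V s" "sgn d"] d(1) by (simp add: norm_sgn assms(2)[OF s])
    ultimately show "V s \<bullet> sgn d = cos \<theta>"
      using cos_arccos_abs[of "V s \<bullet> sgn d"] by simp
  qed
qed

section \<open>The angle function of a principal normal of constant slope\<close>

text \<open>A curve in the unit circle lifts to a differentiable angle. Its derivative must be
  \<open>a' s * b s - a s * b' s\<close>; after integration, the inner product of
  \<open>(a, b)\<close> with \<open>(sin \<phi>, cos \<phi>)\<close> has derivative zero and stays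
  1.\<close>

lemma angle_function:
  fixes a b :: "real \<Rightarrow> real"
  assumes I: "is_interval I"
    and a: "\<And>s. s \<in> I \<Longrightarrow> (a has_real_derivative a' s) (at s within I)"
    and b: "\<And>s. s \<in> I \<Longrightarrow> (b has_real_derivative b' s) (at s within I)"
    and ab': "continuous_on I a'" "continuous_on I b'"
    and ab: "\<And>s. s \<in> I \<Longrightarrow> (a s)\<^sup>2 + (b s)\<^sup>2 = 1" "\<And>s. s \<in> I \<Longrightarrow> a s * a' s + b s * b' s = 0"
  obtains \<phi> \<phi>' where "\<And>s. s \<in> I \<Longrightarrow> (\<phi> has_real_derivative \<phi>' s) (at s within I)"
    "\<And>s. s \<in> I \<Longrightarrow> a s = sin (\<phi> s)" "\<And>s. s \<in> I \<Longrightarrow> b s = cos (\<phi> s)"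
    "\<And>s. s \<in> I \<Longrightarrow> a' s = \<phi>' s * b s" "\<And>s. s \<in> I \<Longrightarrow> b' s = - \<phi>' s * a s"
proof (cases "I = {}")
  case False
  then obtain c where c: "c \<in> I" by blast
  define \<phi>' where "\<phi>' s = a' s * b s - a s * b' s" for s
  have "continuous_on I \<phi>'"
    unfolding \<phi>'_def using ab' DERIV_continuous_on[of I a] DERIV_continuous_on[of I b] a b
    by (intro continuous_intros) blast+
  then obtain \<psi> where \<psi>: "\<And>s. s \<in> I \<Longrightarrow> (\<psi> has_real_derivative \<phi>' s) (at s within I)"
    using real_antiderivative_on_interval[OF I] by blast
  obtain t where t: "a c = sin t" "b c = cos t"
    using sincos_total_2pi[OF ab(1)[OF c, unfolded add.commute[of "(a c)\<^sup>2"]]] by metis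
  \<comment> \<open>The constant makes \<open>\<phi>\<close> start with the angle \<open>t\<close>
    at \<open>c\<close>, so that the inner product equals 1 there.\<close>
  define \<phi> where "\<phi> s = \<psi> s - \<psi> c + t" for s
  have \<phi>: "(\<phi> has_real_derivative \<phi>' s) (at s within I)" if "s \<in> I" for s
    unfolding \<phi>_def using \<psi>[OF that] by (auto intro!: derivative_eq_intros)
  have a': "a' s = \<phi>' s * b s" and b': "b' s = - \<phi>' s * a s" if "s \<in> I" for s
    unfolding \<phi>'_def using ab[OF that] by algebra+
  have "((\<lambda>s. a s * sin (\<phi> s) + b s * cos (\<phi> s)) has_vector_derivative 0) (at s within I)"
    if s: "s \<in> I" for s
    unfolding has_real_derivative_iff_has_vector_derivative[symmetric]
    using a[OF s] b[OF s] \<phi>[OF s]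
    by (auto intro!: derivative_eq_intros simp: a'[OF s] b'[OF s] algebra_simps)
  from has_vector_derivative_zero_eq[OF I this _ c]
  have one: "a s * sin (\<phi> s) + b s * cos (\<phi> s) = 1" if "s \<in> I" for s
    using that by (simp add: t \<phi>_def flip: power2_eq_square)
  \<comment> \<open>Unit vectors with inner product 1 coincide: their squared distance is 2 -
    2.\<close>
  have eq: "(a s - sin (\<phi> s))\<^sup>2 + (b s - cos (\<phi> s))\<^sup>2 = 0" if "s \<in> I" for s
  proof -
    have "(a s - sin (\<phi> s))\<^sup>2 + (b s - cos (\<phi> s))\<^sup>2 =
        ((a s)\<^sup>2 + (b s)\<^sup>2) + ((sin (\<phi> s))\<^sup>2 + (cos (\<phi> s))\<^sup>2)
        - 2 * (a s * sin (\<phi> s) + b s * cos (\<phi> s))"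
      by (simp add: power2_eq_square algebra_simps)
    then show ?thesis using ab(1) one that by simp
  qed
  show thesis
    by (rule that[OF \<phi> _ _ a' b']) (use eq in auto)
qed auto

text \<open>The axis components along \<open>T\<close> and \<open>B\<close>, divided by
  \<open>sin \<theta>\<close>, describe a point of the unit circle. By the Frenet equations and the
  constancy of \<open>N s \<bullet> d\<close>, their derivatives are multiples of
  \<open>\<kappa>\<close> and \<open>\<tau>\<close>; comparison with the derivatives of sine and
  cosine of its angle gives the equations.\<close>

lemma frenet_apparatus_angle:
  assumes app: "frenet_apparatus I x T N B \<kappa> \<tau>" and \<theta>: "0 < \<theta>" "\<theta> < pi / 2"
    and N: "has_constant_slope I N \<theta>"
  obtains \<phi> \<phi>' where "slant_helix_equations I \<theta> \<kappa> \<tau> \<phi> \<phi>'"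
proof -
  have sin: "sin \<theta> > 0" and cos: "cos \<theta> > 0"
    using \<theta> by (auto intro: sin_gt_zero cos_gt_zero)
  have I: "is_interval I"
    using app by (auto simp: frenet_apparatus_def unit_speed_C2_curve_def nondegenerate_interval_def)
  have poo: "positively_oriented_orthonormal (T s) (N s) (B s)" if "s \<in> I" for s
    using app that by (simp add: frenet_apparatus_def)
  have \<kappa>\<tau>: "continuous_on I \<kappa>" "continuous_on I \<tau>"
    using app by (auto simp: frenet_apparatus_def)
  have T: "(T has_vector_derivative \<kappa> s *\<^sub>R N s) (at s within I)"
    and Nd: "(N has_vector_derivative - (\<kappa> s *\<^sub>R T s) + \<tau> s *\<^sub>R B s) (at s within I)"
    and B: "(B has_vector_derivative - (\<tau> s *\<^sub>R N s)) (at s within I)" if "s \<in> I" for s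
    using app that by (auto simp: frenet_apparatus_def)
  have "norm (N s) = 1" if "s \<in> I" for s
    using poo[OF that] by (simp add: positively_oriented_orthonormal_def)
  from has_constant_slopeE[OF N this]
  obtain d where d: "norm d = 1" "\<And>s. s \<in> I \<Longrightarrow> N s \<bullet> d = cos \<theta>" by blast
  define a b where "a s = T s \<bullet> d / sin \<theta>" and "b s = B s \<bullet> d / sin \<theta>" for s
  have deriv: "((\<lambda>s. f s \<bullet> d) has_real_derivative f' \<bullet> d) (at s within I)"
    if "(f has_vector_derivative f') (at s within I)" for f f' s
    unfolding has_real_derivative_iff_has_vector_derivative
    by (rule bounded_linear.has_vector_derivative[OF bounded_linear_inner_left that])
  have a: "(a has_real_derivative cot \<theta> * \<kappa> s) (at s within I)"
    and b: "(b has_real_derivative - (cot \<theta> * \<tau> s)) (at s within I)" if "s \<in> I" for s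
    unfolding a_def b_def using deriv[OF T[OF that]] deriv[OF B[OF that]] sin d(2)[OF that]
    by (auto intro!: derivative_eq_intros simp: cot_def)
  \<comment> \<open>The left side is the derivative of the constant
    \<open>N s \<bullet> d\<close>.\<close>
  have *: "(- (\<kappa> s *\<^sub>R T s) + \<tau> s *\<^sub>R B s) \<bullet> d = 0" if s: "s \<in> I" for s
  proof (rule vector_derivative_unique_within)
    show "at s within I \<noteq> bot"
      using app s nondegenerate_interval_at_within_neq_bot
      unfolding frenet_apparatus_def unit_speed_C2_curve_def by blast
    show "((\<lambda>s. N s \<bullet> d) has_vector_derivative (- (\<kappa> s *\<^sub>R T s) + \<tau> s *\<^sub>R B s) \<bullet> d) (at s within I)"
      using deriv[OF Nd[OF s]] by (simp add: has_real_derivative_iff_has_vector_derivative)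
    show "((\<lambda>s. N s \<bullet> d) has_vector_derivative 0) (at s within I)"
      by (rule has_vector_derivative_transform[OF s _ has_vector_derivative_const]) (use d(2) in auto)
  qed
  \<comment> \<open>The frame matrix preserves the norm of \<open>d\<close>. Removing the known
    component \<open>cos \<theta>\<close> leaves \<open>(sin \<theta>)\<^sup>2\<close> for the other
    two.\<close>
  have ab: "(a s)\<^sup>2 + (b s)\<^sup>2 = 1" if s: "s \<in> I" for s
  proof -
    have "orthogonal_matrix (vector [T s, N s, B s] :: real^3^3)"
      using rotation_matrix_vector[OF poo[OF s]] by (simp add: rotation_matrix_def)
    then have "norm ((vector [T s, N s, B s] :: real^3^3) *v d) = norm d"
      by (metis orthogonal_transformation_matrix orthogonal_transformation_norm
          matrix_of_matrix_vector_mul matrix_vector_mul_linear)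
    then have "(T s \<bullet> d)\<^sup>2 + (N s \<bullet> d)\<^sup>2 + (B s \<bullet> d)\<^sup>2 = 1"
      using d(1) by (simp add: norm_eq_1 inner_vec_def[of "_ *v _"] sum_3 matrix_vector_mul_component
          power2_eq_square)
    then have "(T s \<bullet> d)\<^sup>2 + (B s \<bullet> d)\<^sup>2 = (sin \<theta>)\<^sup>2"
      using d(2)[OF s] by (simp add: sin_squared_eq)
    then show ?thesis
      using sin by (simp add: a_def b_def power_divide flip: add_divide_distrib)
  qed
  \<comment> \<open>This is \<open>*\<close> multiplied by
    \<open>- cot \<theta> / sin \<theta>\<close>.\<close>
  have orth: "a s * (cot \<theta> * \<kappa> s) + b s * - (cot \<theta> * \<tau> s) = 0" if "s \<in> I" for s
    using *[OF that] sin cos by (simp add: a_def b_def cot_def inner_simps field_simps)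
  have cont: "continuous_on I (\<lambda>s. cot \<theta> * \<kappa> s)" "continuous_on I (\<lambda>s. - (cot \<theta> * \<tau> s))"
    using \<kappa>\<tau> by (auto intro!: continuous_intros)
  obtain \<phi> \<phi>' where \<phi>: "\<And>s. s \<in> I \<Longrightarrow> (\<phi> has_real_derivative \<phi>' s) (at s within I)"
    "\<And>s. s \<in> I \<Longrightarrow> a s = sin (\<phi> s)" "\<And>s. s \<in> I \<Longrightarrow> b s = cos (\<phi> s)"
    "\<And>s. s \<in> I \<Longrightarrow> cot \<theta> * \<kappa> s = \<phi>' s * b s"
    "\<And>s. s \<in> I \<Longrightarrow> - (cot \<theta> * \<tau> s) = - \<phi>' s * a s"
    using angle_function[OF I a b cont ab orth] by blast
  have "cot \<theta> \<noteq> 0" using sin cos by (simp add: cot_def)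
  with \<phi> have "slant_helix_equations I \<theta> \<kappa> \<tau> \<phi> \<phi>'"
    by (force simp: slant_helix_equations_def field_simps)
  then show thesis by (rule that)
qed

section \<open>The frame of a slant helix\<close>

text \<open>Recovers a factor from its components; applied to the angle \<open>\<phi> s\<close>, it
  extracts \<open>k s\<close> from curvature and torsion.\<close>

lemma sin_cos_decompose: "cos t * (cos t * c) + sin t * (sin t * c) = (c :: real)"
  using sin_cos_squared_add[of t] by algebra

text \<open>The converse of the characterization and all further properties start from one apparatus
  and one angle function, which are fixed here.\<close>

locale slant_helix_frame =
  fixes I :: "real set" and x T N B :: "real \<Rightarrow> real^3" and \<kappa> \<tau> \<phi> \<phi>' :: "real \<Rightarrow> real"
    and \<theta> :: real
  assumes slope: "0 < \<theta>" "\<theta> < pi / 2"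
    and apparatus: "frenet_apparatus I x T N B \<kappa> \<tau>"
    and equations: "slant_helix_equations I \<theta> \<kappa> \<tau> \<phi> \<phi>'"
begin

text \<open>
  \<open>k\<close> is the curvature of the helix with Frenet frame \<open>(N, - F, E)\<close>, and \<open>(F, G)\<close> is an orthonormal
  basis of the plane perpendicular to the axis.
\<close>

definition k :: "real \<Rightarrow> real" where "k s = \<phi>' s / cot \<theta>"
definition F :: "real \<Rightarrow> real^3" where "F s = cos (\<phi> s) *\<^sub>R T s - sin (\<phi> s) *\<^sub>R B s"
definition E :: "real \<Rightarrow> real^3" where "E s = sin (\<phi> s) *\<^sub>R T s + cos (\<phi> s) *\<^sub>R B s"
definition G :: "real \<Rightarrow> real^3" where "G s = sin \<theta> *\<^sub>R N s - cos \<theta> *\<^sub>R E s"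
text \<open>Taken as a field along the curve, so that it can serve as a frame vector;
  \<open>constant_axis\<close> shows that it does not vary.\<close>

definition axis_at :: "real \<Rightarrow> real^3" where "axis_at s = cos \<theta> *\<^sub>R N s + sin \<theta> *\<^sub>R E s"

section \<open>Signs, the parameter interval and the given equations\<close>

lemma sin_pos: "sin \<theta> > 0" and cos_pos: "cos \<theta> > 0"
  using slope by (auto intro: sin_gt_zero cos_gt_zero)

lemma cot_pos: "cot \<theta> > 0"
  using sin_pos cos_pos by (simp add: cot_def)

lemma \<phi>'_eq: "\<phi>' s = k s * cos \<theta> / sin \<theta>"
  using sin_pos cos_pos by (simp add: k_def cot_def)

lemma interval: "nondegenerate_interval I" "is_interval I"
  using apparatus
  by (auto simp: frenet_apparatus_def unit_speed_C2_curve_def nondegenerate_interval_def)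

lemma frenet_continuous: "continuous_on I \<kappa>" "continuous_on I \<tau>"
  using apparatus by (auto simp: frenet_apparatus_def)

lemma angle: "s \<in> I \<Longrightarrow> (\<phi> has_real_derivative \<phi>' s) (at s within I)"
  using equations by (simp add: slant_helix_equations_def)

lemma curvature: "s \<in> I \<Longrightarrow> \<kappa> s = k s * cos (\<phi> s)"
  and torsion: "s \<in> I \<Longrightarrow> \<tau> s = k s * sin (\<phi> s)"
  using equations by (simp_all add: slant_helix_equations_def k_def)

lemma frame: "s \<in> I \<Longrightarrow> positively_oriented_orthonormal (T s) (N s) (B s)"
  using apparatus by (simp add: frenet_apparatus_def)

lemma norm_normal: "s \<in> I \<Longrightarrow> norm (N s) = 1"
  using frame by (simp add: positively_oriented_orthonormal_def)

lemma deriv_tangent: "s \<in> I \<Longrightarrow> (T has_vector_derivative \<kappa> s *\<^sub>R N s) (at s within I)"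
  and deriv_normal:
    "s \<in> I \<Longrightarrow> (N has_vector_derivative - (\<kappa> s *\<^sub>R T s) + \<tau> s *\<^sub>R B s) (at s within I)"
  and deriv_binormal: "s \<in> I \<Longrightarrow> (B has_vector_derivative - (\<tau> s *\<^sub>R N s)) (at s within I)"
  using apparatus by (auto simp: frenet_apparatus_def)

section \<open>Derivatives of the rotated frame vectors\<close>

lemma normal_deriv_eq: "s \<in> I \<Longrightarrow> - (\<kappa> s *\<^sub>R T s) + \<tau> s *\<^sub>R B s = - k s *\<^sub>R F s"
  by (simp add: curvature torsion F_def algebra_simps)

lemma deriv_N: "s \<in> I \<Longrightarrow> (N has_vector_derivative - k s *\<^sub>R F s) (at s within I)"
  using deriv_normal normal_deriv_eq by metis

lemma deriv_E:
  assumes "s \<in> I"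
  shows "(E has_vector_derivative \<phi>' s *\<^sub>R F s) (at s within I)"
  unfolding E_def[abs_def]
  using deriv_tangent[OF assms] deriv_binormal[OF assms] angle[OF assms]
  by (auto intro!: derivative_eq_intros simp: curvature[OF assms] torsion[OF assms] F_def algebra_simps)

text \<open>Up to sign, the second Frenet equation of the helix with frame
  \<open>(N, - F, E)\<close>.\<close>

lemma deriv_F:
  assumes "s \<in> I"
  shows "(F has_vector_derivative k s *\<^sub>R N s - \<phi>' s *\<^sub>R E s) (at s within I)"
proof -
  have "k s = cos (\<phi> s) * \<kappa> s + sin (\<phi> s) * \<tau> s"
    using assms sin_cos_decompose[of "\<phi> s" "k s"] by (simp add: curvature torsion ac_simps)
  then have "cos (\<phi> s) *\<^sub>R \<kappa> s *\<^sub>R N s + (- sin (\<phi> s) * \<phi>' s) *\<^sub>R T s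
      - (sin (\<phi> s) *\<^sub>R - (\<tau> s *\<^sub>R N s) + (cos (\<phi> s) * \<phi>' s) *\<^sub>R B s)
    = k s *\<^sub>R N s - \<phi>' s *\<^sub>R E s"
    by (simp add: E_def algebra_simps)
  then show ?thesis
    unfolding F_def[abs_def]
    using deriv_tangent[OF assms] deriv_binormal[OF assms] angle[OF assms]
    by (auto intro!: derivative_eq_intros)
qed

text \<open>Together with \<open>deriv_F_eq\<close>, this says that \<open>(F, G)\<close> turns at
  the rate \<open>\<phi>' s / cos \<theta>\<close>, the derivative of \<open>\<Omega>\<close>. Both
  sides of the scalar identity equal \<open>k s / sin \<theta>\<close>.\<close>

lemma deriv_G:
  assumes "s \<in> I"
  shows "(G has_vector_derivative - (\<phi>' s / cos \<theta>) *\<^sub>R F s) (at s within I)"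
proof -
  have "k s * sin \<theta> + \<phi>' s * cos \<theta> = \<phi>' s / cos \<theta>"
    using sin_pos cos_pos sin_cos_decompose[of \<theta> "k s"]
    by (simp add: \<phi>'_eq field_simps)
  moreover have "sin \<theta> *\<^sub>R (- k s *\<^sub>R F s) - cos \<theta> *\<^sub>R (\<phi>' s *\<^sub>R F s) =
      - (k s * sin \<theta> + \<phi>' s * cos \<theta>) *\<^sub>R F s"
    by (simp add: algebra_simps)
  ultimately have "sin \<theta> *\<^sub>R (- k s *\<^sub>R F s) - cos \<theta> *\<^sub>R (\<phi>' s *\<^sub>R F s) =
      - (\<phi>' s / cos \<theta>) *\<^sub>R F s"
    by simp
  then show ?thesis
    unfolding G_def[abs_def] using deriv_N[OF assms] deriv_E[OF assms]
    by (auto intro!: derivative_eq_intros)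
qed

lemma deriv_F_eq:
  assumes "s \<in> I"
  shows "(F has_vector_derivative (\<phi>' s / cos \<theta>) *\<^sub>R G s) (at s within I)"
proof -
  have "k s *\<^sub>R N s - \<phi>' s *\<^sub>R E s = (\<phi>' s / cos \<theta>) *\<^sub>R G s"
    using sin_pos cos_pos by (simp add: G_def \<phi>'_eq scaleR_diff_right)
  then show ?thesis using deriv_F[OF assms] by simp
qed

text \<open>The contributions \<open>- k s * cos \<theta>\<close> of \<open>N\<close> and
  \<open>\<phi>' s * sin \<theta>\<close> of \<open>E\<close> along \<open>F\<close> cancel.\<close>

lemma deriv_axis: "s \<in> I \<Longrightarrow> (axis_at has_vector_derivative 0) (at s within I)"
  unfolding axis_at_def[abs_def] using deriv_N deriv_E sin_pos
  by (auto intro!: derivative_eq_intros simp: \<phi>'_eq)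

section \<open>The frame of the helix, the frame of the axis, and the constancy of the axis\<close>

lemma helix_frame:
  assumes "s \<in> I"
  shows "positively_oriented_orthonormal (N s) (- F s) (E s)"
proof -
  have "positively_oriented_orthonormal (B s) (T s) (N s)"
    using frame[OF assms] positively_oriented_orthonormal_cyclic by blast
  \<comment> \<open>A rotation in the plane of \<open>B\<close> and \<open>T\<close>, which fixes
    \<open>N\<close>.\<close>
  from positively_oriented_orthonormal_rotate[OF this, of "sin (\<phi> s)" "- cos (\<phi> s)"]
  have "positively_oriented_orthonormal (- F s) (E s) (N s)"
    by (simp add: F_def E_def algebra_simps)
  then show ?thesis
    using positively_oriented_orthonormal_cyclic by blast
qed

text \<open>Rotating \<open>E\<close> and \<open>N\<close> in their plane yields \<open>G\<close>
  and the axis, while \<open>F\<close> is kept up to sign.\<close>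

lemma precession_frame:
  assumes "s \<in> I"
  shows "positively_oriented_orthonormal (F s) (G s) (axis_at s)"
proof -
  have "positively_oriented_orthonormal (E s) (N s) (- F s)"
    using helix_frame[OF assms] positively_oriented_orthonormal_cyclic by blast
  from positively_oriented_orthonormal_rotate[OF this, of "- cos \<theta>" "sin \<theta>"]
  have "positively_oriented_orthonormal (G s) (- axis_at s) (- F s)"
    by (simp add: G_def axis_at_def algebra_simps)
  then have "positively_oriented_orthonormal (- axis_at s) (- F s) (G s)"
    using positively_oriented_orthonormal_cyclic by blast
  \<comment> \<open>A half turn about \<open>G\<close> removes both minus signs.\<close>
  from positively_oriented_orthonormal_rotate[OF this, of "-1" 0]
  have "positively_oriented_orthonormal (axis_at s) (F s) (G s)"
    by simp
  then show ?thesis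
    using positively_oriented_orthonormal_cyclic by blast
qed

lemma constant_axis:
  obtains d where "norm d = 1" "\<And>s. s \<in> I \<Longrightarrow> axis_at s = d"
proof -
  obtain c where c: "c \<in> I"
    using interval(1) by (auto simp: nondegenerate_interval_def)
  show thesis
  proof
    show "norm (axis_at c) = 1"
      using precession_frame[OF c] by (simp add: positively_oriented_orthonormal_def)
    show "axis_at s = axis_at c" if "s \<in> I" for s
      by (rule has_vector_derivative_zero_eq[OF interval(2) deriv_axis that c])
  qed
qed

section \<open>Slopes of the principal normal and of the Darboux vector\<close>

lemma inner_axis: "s \<in> I \<Longrightarrow> N s \<bullet> axis_at s = cos \<theta>" "s \<in> I \<Longrightarrow> E s \<bullet> axis_at s = sin \<theta>"
  using positively_oriented_orthonormal_inner[OF helix_frame]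
  by (simp_all add: axis_at_def inner_simps)

lemma constant_slope_normal: "has_constant_slope I N \<theta>"
proof -
  obtain d where "norm d = 1" "\<And>s. s \<in> I \<Longrightarrow> axis_at s = d" using constant_axis by blast
  then show ?thesis
    using inner_axis(1) slope norm_normal by (intro has_constant_slopeI[of d]) auto
qed

lemma darboux_eq: "s \<in> I \<Longrightarrow> darboux_vector T B \<kappa> \<tau> s = k s *\<^sub>R E s"
  by (simp add: darboux_vector_def E_def curvature torsion algebra_simps)

lemma norm_E: "s \<in> I \<Longrightarrow> norm (E s) = 1"
  using helix_frame by (simp add: positively_oriented_orthonormal_def)

text \<open>A nonnegative factor preserves the angle with the axis; a negative one would replace it
  by its supplement. The factor 1 gives \<open>E\<close> itself, the factor \<open>k\<close> the
  Darboux vector.\<close>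

lemma constant_slope_darboux:
  assumes "J \<subseteq> I" "\<And>s. s \<in> J \<Longrightarrow> 0 \<le> c s" "\<And>s. s \<in> J \<Longrightarrow> V s = c s *\<^sub>R E s"
  shows "has_constant_slope J V (pi / 2 - \<theta>)"
proof -
  obtain d where "norm d = 1" "\<And>s. s \<in> I \<Longrightarrow> axis_at s = d" using constant_axis by blast
  moreover have "V s \<bullet> axis_at s = norm (V s) * cos (pi / 2 - \<theta>)" if "s \<in> J" for s
    using that assms inner_axis(2)[of s] norm_E[of s] by (auto simp: cos_diff)
  ultimately show ?thesis
    using assms(1) slope by (intro has_constant_slopeI[of d]) auto
qed

lemma angular_speed_eq: "s \<in> I \<Longrightarrow> angular_speed \<kappa> \<tau> s = \<bar>k s\<bar>"
  by (simp add: angular_speed_def curvature torsion power_mult_distrib flip: distrib_left)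

text \<open>Only differentiability of \<open>\<phi>\<close> is given. Continuity of its derivative
  comes from \<open>\<kappa>\<close> and \<open>\<tau>\<close>, by solving the equations for
  \<open>\<phi>' s\<close>.\<close>

lemma continuous_\<phi>': "continuous_on I \<phi>'"
proof -
  have "\<phi>' s = cot \<theta> * (\<kappa> s * cos (\<phi> s) + \<tau> s * sin (\<phi> s))" if "s \<in> I" for s
  proof -
    have "\<kappa> s * cos (\<phi> s) + \<tau> s * sin (\<phi> s) = k s"
      using that sin_cos_decompose[of "\<phi> s" "k s"] by (simp add: curvature torsion ac_simps)
    then show ?thesis using cot_pos by (simp add: k_def)
  qed
  moreover have "continuous_on I (\<lambda>s. cot \<theta> * (\<kappa> s * cos (\<phi> s) + \<tau> s * sin (\<phi> s)))"
    using frenet_continuous DERIV_continuous_on[OF angle] by (intro continuous_intros)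
  ultimately show ?thesis by (simp cong: continuous_on_cong)
qed

text \<open>Turning \<open>(F, G)\<close> back by \<open>\<Omega>\<close> gives constant vectors
  \<open>e1\<close> and \<open>e2\<close>. With the axis they form the rows of a rotation matrix,
  and its product with \<open>T s\<close> lists the components of the tangent.\<close>

lemma rigid_motion_tangent:
  "\<exists>g. rigid_motion g \<and>
     (\<forall>s\<in>I. ((g \<circ> x) has_vector_derivative slant_helix_tangent \<theta> \<phi> s) (at s within I))"
proof -
  define \<Omega> where "\<Omega> s = \<phi> s / cos \<theta>" for s
  define e1 where "e1 s = cos (\<Omega> s) *\<^sub>R F s + (- sin (\<Omega> s)) *\<^sub>R G s" for s
  define e2 where "e2 s = cos (\<Omega> s) *\<^sub>R G s - (- sin (\<Omega> s)) *\<^sub>R F s" for s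
  have \<Omega>: "(\<Omega> has_real_derivative \<phi>' s / cos \<theta>) (at s within I)" if "s \<in> I" for s
    unfolding \<Omega>_def[abs_def] by (rule DERIV_cdivide[OF angle[OF that]])
  have "(e1 has_vector_derivative 0) (at s within I)" "(e2 has_vector_derivative 0) (at s within I)"
    if "s \<in> I" for s
    unfolding e1_def[abs_def] e2_def[abs_def]
    using \<Omega>[OF that] deriv_F_eq[OF that] deriv_G[OF that]
    by (auto intro!: derivative_eq_intros simp: algebra_simps)
  note const = this[THEN has_vector_derivative_zero_eq[OF interval(2)]]
    deriv_axis[THEN has_vector_derivative_zero_eq[OF interval(2)]]
  obtain c where c: "c \<in> I"
    using interval(1) by (auto simp: nondegenerate_interval_def)
  define R where "R = (vector [e1 c, e2 c, axis_at c] :: real^3^3)"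
  have "rotation_matrix R"
    unfolding R_def e1_def e2_def
    using precession_frame[OF c]
    by (intro rotation_matrix_vector positively_oriented_orthonormal_rotate) auto
  then have "rigid_motion ((*v) R)"
    unfolding rigid_motion_def by (intro exI[of _ R] exI[of _ 0]) auto
  moreover have "(((*v) R \<circ> x) has_vector_derivative slant_helix_tangent \<theta> \<phi> s) (at s within I)"
    if s: "s \<in> I" for s
  proof -
    \<comment> \<open>All three rows are constant, so the matrix taken at \<open>c\<close> may be
      read at \<open>s\<close>.\<close>
    have R: "R = vector [e1 s, e2 s, axis_at s]"
      unfolding R_def using const s c by metis
    note inner = positively_oriented_orthonormal_inner[OF frame[OF s]]
    have "F s \<bullet> T s = cos (\<phi> s)" "E s \<bullet> T s = sin (\<phi> s)" "N s \<bullet> T s = 0"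
      using inner by (simp_all add: F_def E_def inner_simps)
    then have dots: "e1 s \<bullet> T s = cos (\<Omega> s) * cos (\<phi> s) + cos \<theta> * (sin (\<Omega> s) * sin (\<phi> s))"
      "e2 s \<bullet> T s = sin (\<Omega> s) * cos (\<phi> s) - cos \<theta> * (cos (\<Omega> s) * sin (\<phi> s))"
      "axis_at s \<bullet> T s = sin \<theta> * sin (\<phi> s)"
      by (simp_all add: e1_def e2_def G_def axis_at_def inner_simps)
    \<comment> \<open>The arguments are the difference and the sum of \<open>\<Omega> s\<close> and
      \<open>\<phi> s\<close>, so the addition theorems reduce the formula to
      \<open>dots\<close>.\<close>
    have args: "(1 - cos \<theta>) * (\<phi> s / cos \<theta>) = \<Omega> s - \<phi> s"
      "(1 + cos \<theta>) * (\<phi> s / cos \<theta>) = \<Omega> s + \<phi> s" "cos \<theta> * (\<phi> s / cos \<theta>) = \<phi> s"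
      "cos \<theta> / cot \<theta> = sin \<theta>"
      using sin_pos cos_pos by (simp_all add: \<Omega>_def cot_def field_simps)
    have "R *v T s = slant_helix_tangent \<theta> \<phi> s"
      unfolding R slant_helix_tangent_def Let_def args
      by (simp add: vec_eq_iff forall_3 matrix_vector_mul_component dots cos_add cos_diff sin_add
          sin_diff algebra_simps)
    moreover have "(x has_vector_derivative T s) (at s within I)"
      using apparatus s by (simp add: frenet_apparatus_def)
    from bounded_linear.has_vector_derivative[OF matrix_vector_mul_bounded_linear this, of R]
    have "(((*v) R \<circ> x) has_vector_derivative R *v T s) (at s within I)"
      by (simp add: o_def)
    ultimately show ?thesis
      by simp
  qed
  ultimately show ?thesis by blast
qed

text \<open>The helix is an antiderivative of \<open>N\<close>: its unit tangent is the principal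
  normal of \<open>x\<close>, which has constant slope, and its Frenet frame is
  \<open>(N, - F, E)\<close>.\<close>

lemma successor_of_helix:
  "\<exists>y. helix I y \<and> frenet_development I y k \<phi>' \<and> successor_curve I y x \<and>
     (\<forall>s\<in>I. unit_tangent I y s = N s)"
proof -
  have "continuous_on I N"
    using deriv_N by (rule continuous_on_has_vector_derivative)
  then obtain y where y: "\<And>s. s \<in> I \<Longrightarrow> (y has_vector_derivative N s) (at s within I)"
    using antiderivative_on_interval[OF interval(2)] by blast
  have "continuous_on I (\<lambda>s. - k s *\<^sub>R F s)"
    unfolding k_def using continuous_\<phi>' cot_pos continuous_on_has_vector_derivative[OF deriv_F]
    by (intro continuous_intros) auto
  then have C2: "unit_speed_C2_curve I y"
    unfolding unit_speed_C2_curve_def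
    by (intro conjI exI[of _ N] exI[of _ "\<lambda>s. - k s *\<^sub>R F s"] ballI y deriv_N interval norm_normal)
  have tangent: "unit_tangent I y s = N s" if "s \<in> I" for s
    by (rule unit_tangent_eqI[OF interval(1) that y[OF that]])
  have "has_constant_slope I (unit_tangent I y) \<theta>"
    using constant_slope_normal tangent by (simp add: has_constant_slope_def)
  with C2 have helix: "helix I y"
    by (auto simp: helix_def)
  have "((\<lambda>s. - F s) has_vector_derivative - (k s *\<^sub>R N s) + \<phi>' s *\<^sub>R E s) (at s within I)"
    if "s \<in> I" for s
    using deriv_F[OF that] by (auto intro!: derivative_eq_intros)
  moreover have "(N has_vector_derivative k s *\<^sub>R (- F s)) (at s within I)"
    "(E has_vector_derivative - (\<phi>' s *\<^sub>R (- F s))) (at s within I)" if "s \<in> I" for s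
    using deriv_N[OF that] deriv_E[OF that] by simp_all
  moreover have "continuous_on I k"
    unfolding k_def[abs_def] using continuous_\<phi>' cot_pos by (intro continuous_intros) auto
  ultimately have "frenet_apparatus I y N (\<lambda>s. - F s) E k \<phi>'"
    unfolding frenet_apparatus_def using C2 y helix_frame continuous_\<phi>' by blast
  then have "frenet_development I y k \<phi>'"
    unfolding frenet_development_def by blast
  moreover have "successor_curve I y x"
    unfolding successor_curve_def using C2 apparatus tangent by fastforce
  ultimately show ?thesis
    using helix tangent by blast
qed

text \<open>\<open>T\<close> runs on the unit sphere with velocity
  \<open>\<kappa> s *\<^sub>R N s\<close>. On a regular arc \<open>\<kappa>\<close> has a fixed sign
  \<open>e\<close>, so the unit tangent of the arc is \<open>e\<close> times \<open>N\<close> and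
  inherits the constant slope.\<close>

lemma spherical_helix_arc:
  assumes J: "J \<subseteq> I" and arc: "regular_C1_arc J T"
  shows "\<exists>K y. reparametrizes K y J T \<and> spherical_helix K y"
proof -
  have J': "nondegenerate_interval J" "connected J"
    using arc by (auto simp: regular_C1_arc_def nondegenerate_interval_def is_interval_connected_1)
  obtain c' where c': "\<And>s. s \<in> J \<Longrightarrow> (T has_vector_derivative c' s) (at s within J) \<and> c' s \<noteq> 0"
    using arc by (auto simp: regular_C1_arc_def)
  have deriv: "(f has_vector_derivative f') (at s within J)"
    if "(f has_vector_derivative f') (at s within I)" for f :: "real \<Rightarrow> real^3" and f' s
    using that J by (rule has_vector_derivative_within_subset)
  \<comment> \<open>Regularity makes the velocity nonzero, and by uniqueness of the derivative it is
    \<open>\<kappa> s *\<^sub>R N s\<close>.\<close>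
  have nz: "\<kappa> s \<noteq> 0" if s: "s \<in> J" for s
  proof -
    have "c' s = \<kappa> s *\<^sub>R N s"
      using vector_derivative_unique_within nondegenerate_interval_at_within_neq_bot[OF J'(1) s]
        c'[OF s] deriv[OF deriv_tangent] s J by blast
    with c'[OF s] show ?thesis by auto
  qed
  have cont: "continuous_on J \<kappa>" "continuous_on J \<tau>"
    using frenet_continuous J continuous_on_subset by blast+
  have "is_interval (\<kappa> ` J)"
    using connected_continuous_image[OF cont(1) J'(2)] is_interval_connected_1 by blast
  \<comment> \<open>The image of \<open>J\<close> under \<open>\<kappa>\<close> is an interval that
    omits 0.\<close>
  then have same_sign: "\<not> (\<kappa> s < 0 \<and> 0 < \<kappa> t)" if "s \<in> J" "t \<in> J" for s t
    using nz that mem_is_interval_1_I[of "\<kappa> ` J" "\<kappa> s" "\<kappa> t" 0] by fastforce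
  obtain e :: real where e: "e = 1 \<or> e = -1" "\<And>s. s \<in> J \<Longrightarrow> 0 < e * \<kappa> s"
  proof (cases "\<exists>s\<in>J. \<kappa> s < 0")
    case True
    then obtain s where s: "s \<in> J" "\<kappa> s < 0" by blast
    have "\<kappa> t < 0" if "t \<in> J" for t
      using same_sign[OF s(1) that] nz[OF that] s(2) by linarith
    then show thesis by (intro that[of "-1"]) auto
  next
    case False
    then show thesis using nz by (intro that[of 1]) force+
  qed
  define u where "u s = e *\<^sub>R N s" for s
  have norm_u: "norm (u s) = 1" if "s \<in> J" for s
    using e(1) norm_normal that J by (auto simp: u_def)
  obtain K y where Ky: "reparametrizes K y J T" "unit_speed_C2_curve K y"
    and K: "\<And>q. q \<in> K \<Longrightarrow> \<exists>s\<in>J. y q = T s \<and> unit_tangent K y q = u s"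
  proof (rule arc_length_reparametrization[OF J'(1), of T "\<lambda>s. e * \<kappa> s" u
        "\<lambda>s. e *\<^sub>R (- (\<kappa> s *\<^sub>R T s) + \<tau> s *\<^sub>R B s)"])
    show "(T has_vector_derivative (e * \<kappa> s) *\<^sub>R u s) (at s within J)" if "s \<in> J" for s
      using deriv[OF deriv_tangent] that J e(1) by (auto simp: u_def)
    show "(u has_vector_derivative e *\<^sub>R (- (\<kappa> s *\<^sub>R T s) + \<tau> s *\<^sub>R B s)) (at s within J)"
      if "s \<in> J" for s
      using deriv[OF deriv_normal, of s] that J unfolding u_def
      by (intro bounded_linear.has_vector_derivative[OF bounded_linear_scaleR_right]) auto
    have "continuous_on J T" "continuous_on J B"
      using continuous_on_has_vector_derivative[OF deriv_tangent]
        continuous_on_has_vector_derivative[OF deriv_binormal] continuous_on_subset[OF _ J]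
      by auto
    then show "continuous_on J (\<lambda>s. e *\<^sub>R (- (\<kappa> s *\<^sub>R T s) + \<tau> s *\<^sub>R B s))"
      using cont by (intro continuous_intros)
    show "continuous_on J (\<lambda>s. e * \<kappa> s)"
      using cont by (intro continuous_intros)
  qed (use e(2) norm_u in auto)
  obtain d where d: "norm d = 1" "\<And>s. s \<in> I \<Longrightarrow> axis_at s = d" using constant_axis by blast
  have "has_constant_slope K (unit_tangent K y) \<theta>"
  \<comment> \<open>The direction carries the same sign as the tangent, so that the angle is
    \<open>\<theta>\<close> and not its supplement.\<close>
  proof (rule has_constant_slopeI[of "e *\<^sub>R d"])
    show "unit_tangent K y q \<bullet> e *\<^sub>R d = norm (unit_tangent K y q) * cos \<theta>" if q: "q \<in> K" for q
    proof -
      obtain s where "s \<in> J" "unit_tangent K y q = u s" using K[OF q] by blast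
      then show ?thesis
        using norm_u[of s] e(1) inner_axis(1)[of s] d(2)[of s] J by (auto simp: u_def)
    qed
  qed (use e(1) d(1) slope in auto)
  with Ky(2) have "helix K y"
    by (auto simp: helix_def)
  moreover have "norm (T s) = 1" if "s \<in> J" for s
    using frame[of s] that J by (auto simp: positively_oriented_orthonormal_def)
  then have "y ` K \<subseteq> sphere 0 1"
    using K by fastforce
  ultimately have "spherical_helix K y"
    unfolding spherical_helix_def using zero_less_one by blast
  with Ky(1) show ?thesis by blast
qed

text \<open>Where \<open>\<kappa>\<close> vanishes, \<open>k s * cos (\<phi> s)\<close> is zero, so
  \<open>sin (\<phi> s)\<close> has derivative zero and is constant. Either
  \<open>cos (\<phi> s)\<close> is nonzero and \<open>k s\<close> vanishes, or the cosine is zero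
  throughout \<open>J\<close> and its derivative gives
  \<open>sin (\<phi> s) * \<phi>' s = 0\<close>.\<close>

lemma generic: "generic_development I \<kappa> \<tau>"
  unfolding generic_development_def
proof (intro allI impI)
  fix J assume "nondegenerate_interval J \<and> J \<subseteq> I \<and> (\<forall>s\<in>J. \<kappa> s = 0)"
  then have J: "nondegenerate_interval J" "is_interval J" "J \<subseteq> I" and "\<And>s. s \<in> J \<Longrightarrow> \<kappa> s = 0"
    by (auto simp: nondegenerate_interval_def)
  then have zero: "k s * cos (\<phi> s) = 0" if "s \<in> J" for s
    using curvature[of s] that by auto
  have angle': "(\<phi> has_real_derivative \<phi>' s) (at s within J)" if "s \<in> J" for s
    using DERIV_subset[OF angle J(3)] that J(3) by blast
  have "((\<lambda>s. sin (\<phi> s)) has_vector_derivative 0) (at s within J)" if "s \<in> J" for s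
    unfolding has_real_derivative_iff_has_vector_derivative[symmetric]
    using angle'[OF that] zero[OF that] by (auto intro!: derivative_eq_intros simp: \<phi>'_eq)
  from has_vector_derivative_zero_eq[OF J(2) this]
  have const: "sin (\<phi> s) = sin (\<phi> t)" if "s \<in> J" "t \<in> J" for s t
    using that by blast
  show "\<forall>s\<in>J. \<tau> s = 0"
  proof
    fix s assume s: "s \<in> J"
    show "\<tau> s = 0"
    proof (cases "cos (\<phi> s) = 0")
      case True
      \<comment> \<open>A constant sine has a constant squared cosine.\<close>
      have "cos (\<phi> t) = 0" if "t \<in> J" for t
        using True const[OF that s] sin_cos_squared_add[of "\<phi> t"] sin_cos_squared_add[of "\<phi> s"]
        by simp
      then have "((\<lambda>s. cos (\<phi> s)) has_vector_derivative 0) (at s within J)"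
        by (intro has_vector_derivative_transform[OF s _ has_vector_derivative_const]) auto
      moreover have "((\<lambda>s. cos (\<phi> s)) has_vector_derivative - sin (\<phi> s) * \<phi>' s) (at s within J)"
        unfolding has_real_derivative_iff_has_vector_derivative[symmetric]
        using angle'[OF s] by (auto intro!: derivative_eq_intros)
      ultimately have "- sin (\<phi> s) * \<phi>' s = 0"
        using vector_derivative_unique_within nondegenerate_interval_at_within_neq_bot[OF J(1) s]
        by blast
      then show ?thesis
        using s J(3) torsion[of s] by (auto simp: k_def)
    next
      case False
      then show ?thesis
        using s J(3) torsion[of s] zero[OF s] by auto
    qed
  qed
qed

end

text \<open>Where \<open>\<phi>'\<close> is negative, the Darboux vector points against the
  continuous unit field \<open>E\<close>. Hence on all of \<open>I\<close> the slope belongs to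
  \<open>E\<close> and the speed is an absolute value, while the forms without these provisos are
  stated where \<open>\<phi>'\<close> is nonnegative.\<close>

theorem theorem4p2:
  fixes I :: "real set" and x :: "real \<Rightarrow> real^3"
  assumes "unit_speed_C2_curve I x"
  shows
    "(slant_helix I x \<longleftrightarrow>
        (\<exists>\<theta> \<kappa> \<tau> \<phi> \<phi>'. 0 < \<theta> \<and> \<theta> < pi / 2 \<and> frenet_development I x \<kappa> \<tau> \<and>
            slant_helix_equations I \<theta> \<kappa> \<tau> \<phi> \<phi>')) \<and>
     (\<forall>\<theta>. 0 < \<theta> \<and> \<theta> < pi / 2 \<longrightarrow>
        (slant_helix_of_slope I x \<theta> \<longleftrightarrow>
           (\<exists>\<kappa> \<tau> \<phi> \<phi>'. frenet_development I x \<kappa> \<tau> \<and> slant_helix_equations I \<theta> \<kappa> \<tau> \<phi> \<phi>'))) \<and>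
     (\<forall>\<theta> T N B \<kappa> \<tau> \<phi> \<phi>'.
        0 < \<theta> \<and> \<theta> < pi / 2 \<and> frenet_apparatus I x T N B \<kappa> \<tau> \<and>
        slant_helix_equations I \<theta> \<kappa> \<tau> \<phi> \<phi>' \<longrightarrow>
          (\<exists>g. rigid_motion g \<and>
             (\<forall>s\<in>I. ((g \<circ> x) has_vector_derivative slant_helix_tangent \<theta> \<phi> s) (at s within I))) \<and>
          (\<exists>y. helix I y \<and> frenet_development I y (\<lambda>s. \<phi>' s / cot \<theta>) \<phi>' \<and>
             successor_curve I y x \<and> (\<forall>s\<in>I. unit_tangent I y s = N s)) \<and>
          (\<forall>J. J \<subseteq> I \<and> regular_C1_arc J T \<longrightarrow>
             (\<exists>K y. reparametrizes K y J T \<and> spherical_helix K y)) \<and>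
          (\<exists>E. continuous_on I E \<and>
             (\<forall>s\<in>I. norm (E s) = 1 \<and> darboux_vector T B \<kappa> \<tau> s = (\<phi>' s / cot \<theta>) *\<^sub>R E s) \<and>
             has_constant_slope I E (pi / 2 - \<theta>)) \<and>
          (\<forall>s\<in>I. angular_speed \<kappa> \<tau> s = \<bar>\<phi>' s / cot \<theta>\<bar>) \<and>
          has_constant_slope {s\<in>I. 0 \<le> \<phi>' s} (darboux_vector T B \<kappa> \<tau>) (pi / 2 - \<theta>) \<and>
          (\<forall>s\<in>{s\<in>I. 0 \<le> \<phi>' s}. angular_speed \<kappa> \<tau> s = \<phi>' s / cot \<theta>) \<and>
          generic_development I \<kappa> \<tau>) \<and>
     (slant_helix I x \<longrightarrow> generic_frenet_curve I x)"
proof -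
  have slope_iff: "slant_helix_of_slope I x \<theta> \<longleftrightarrow>
      (\<exists>\<kappa> \<tau> \<phi> \<phi>'. frenet_development I x \<kappa> \<tau> \<and> slant_helix_equations I \<theta> \<kappa> \<tau> \<phi> \<phi>')"
    if \<theta>: "0 < \<theta>" "\<theta> < pi / 2" for \<theta>
  proof
    assume "slant_helix_of_slope I x \<theta>"
    then obtain T N B \<kappa> \<tau> where app: "frenet_apparatus I x T N B \<kappa> \<tau>" "has_constant_slope I N \<theta>"
      unfolding slant_helix_of_slope_def by blast
    obtain \<phi> \<phi>' where "slant_helix_equations I \<theta> \<kappa> \<tau> \<phi> \<phi>'"
      by (rule frenet_apparatus_angle[OF app(1) \<theta> app(2)])
    with app(1) show "\<exists>\<kappa> \<tau> \<phi> \<phi>'. frenet_development I x \<kappa> \<tau> \<and> slant_helix_equations I \<theta> \<kappa> \<tau> \<phi> \<phi>'"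
      unfolding frenet_development_def by blast
  next
    assume "\<exists>\<kappa> \<tau> \<phi> \<phi>'. frenet_development I x \<kappa> \<tau> \<and> slant_helix_equations I \<theta> \<kappa> \<tau> \<phi> \<phi>'"
    then obtain T N B \<kappa> \<tau> \<phi> \<phi>' where app: "frenet_apparatus I x T N B \<kappa> \<tau>"
      and "slant_helix_equations I \<theta> \<kappa> \<tau> \<phi> \<phi>'"
      unfolding frenet_development_def by blast
    then interpret slant_helix_frame I x T N B \<kappa> \<tau> \<phi> \<phi>' \<theta>
      using \<theta> by unfold_locales
    show "slant_helix_of_slope I x \<theta>"
      unfolding slant_helix_of_slope_def using app constant_slope_normal by blast
  qed
  have slant_iff: "slant_helix I x \<longleftrightarrow>
      (\<exists>\<theta> \<kappa> \<tau> \<phi> \<phi>'. 0 < \<theta> \<and> \<theta> < pi / 2 \<and> frenet_development I x \<kappa> \<tau> \<and>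
        slant_helix_equations I \<theta> \<kappa> \<tau> \<phi> \<phi>')"
    unfolding slant_helix_def using slope_iff by blast
  have generic: "generic_frenet_curve I x" if "slant_helix I x"
  proof -
    obtain \<theta> T N B \<kappa> \<tau> \<phi> \<phi>' where \<theta>: "0 < \<theta>" "\<theta> < pi / 2"
      and app: "frenet_apparatus I x T N B \<kappa> \<tau>" and "slant_helix_equations I \<theta> \<kappa> \<tau> \<phi> \<phi>'"
      using \<open>slant_helix I x\<close> unfolding slant_iff frenet_development_def by blast
    then interpret slant_helix_frame I x T N B \<kappa> \<tau> \<phi> \<phi>' \<theta>
      by unfold_locales
    show ?thesis
      unfolding generic_frenet_curve_def using app generic by blast
  qed
  show ?thesis
  proof (intro conjI allI impI)
    fix \<theta> T N B \<kappa> \<tau> \<phi> \<phi>'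
    assume "0 < \<theta> \<and> \<theta> < pi / 2 \<and> frenet_apparatus I x T N B \<kappa> \<tau> \<and>
        slant_helix_equations I \<theta> \<kappa> \<tau> \<phi> \<phi>'"
    then interpret slant_helix_frame I x T N B \<kappa> \<tau> \<phi> \<phi>' \<theta>
      by unfold_locales auto
    show "\<exists>g. rigid_motion g \<and>
        (\<forall>s\<in>I. ((g \<circ> x) has_vector_derivative slant_helix_tangent \<theta> \<phi> s) (at s within I))"
      by (rule rigid_motion_tangent)
    show "\<exists>y. helix I y \<and> frenet_development I y (\<lambda>s. \<phi>' s / cot \<theta>) \<phi>' \<and>
        successor_curve I y x \<and> (\<forall>s\<in>I. unit_tangent I y s = N s)"
      using successor_of_helix unfolding k_def[abs_def] .
    show "\<exists>K y. reparametrizes K y J T \<and> spherical_helix K y" if "J \<subseteq> I \<and> regular_C1_arc J T" for J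
      using that spherical_helix_arc by blast
    show "\<exists>E. continuous_on I E \<and>
        (\<forall>s\<in>I. norm (E s) = 1 \<and> darboux_vector T B \<kappa> \<tau> s = (\<phi>' s / cot \<theta>) *\<^sub>R E s) \<and>
        has_constant_slope I E (pi / 2 - \<theta>)"
      using continuous_on_has_vector_derivative[OF deriv_E] norm_E darboux_eq
        constant_slope_darboux[of I "\<lambda>_. 1" E]
      by (intro exI[of _ E]) (simp add: k_def)
    show "\<forall>s\<in>I. angular_speed \<kappa> \<tau> s = \<bar>\<phi>' s / cot \<theta>\<bar>"
      using angular_speed_eq by (simp add: k_def)
    \<comment> \<open>Here the factor \<open>k s\<close> is nonnegative, because
      \<open>cot \<theta>\<close> is positive.\<close>
    show "has_constant_slope {s\<in>I. 0 \<le> \<phi>' s} (darboux_vector T B \<kappa> \<tau>) (pi / 2 - \<theta>)"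
      using darboux_eq cot_pos by (intro constant_slope_darboux[of _ k]) (auto simp: k_def)
    show "\<forall>s\<in>{s\<in>I. 0 \<le> \<phi>' s}. angular_speed \<kappa> \<tau> s = \<phi>' s / cot \<theta>"
      using angular_speed_eq cot_pos by (simp add: k_def)
    show "generic_development I \<kappa> \<tau>"
      by (rule generic)
  qed (use slant_iff slope_iff generic in blast)+
qed

end
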